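(* Let $r\geq 1$ be an integer and let \[ \eta = \begin{cases} 1 & \text{if $r$ is odd},\\ 0 & \text{if $r$ is even}.\end{cases} \] Let $h:\mathbb{Z}_{\geq 1}\to\mathbb{C}$ satisfy $|h(d)| \ll d^\alpha$ for some $\alpha\in\left[0,\frac{r+2-\eta}{2r-2+2\eta}\right)$, and define $f:\mathbb{Z}_{\geq 1}\to\mathbb{C}$ by \[ f(n) = \begin{cases} h(d) & \text{if $n=d^r$ for a positive integer $d$},\\ 0 & \text{otherwise}.\end{cases} \] Then, for $x\geq 2$, \[ \sum_{n\leq x} f\left(\left\lfloor \frac{x}{n}\right\rfloor\right) = C_f x + O\left(x^{\frac{2(1+\alpha)}{3r+\eta}}\right), \qquad\text{where}\qquad C_f = \sum_{n=1}^\infty \frac{f(n)}{n(n+1)}. \]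
   Context: $\lfloor t\rfloor$ denotes the integer part of $t$. The sum over $n$ runs over positive integers $n\le x$. The implied constants in $\ll$ and $O$ may depend on $r$ and on $h$ (in particular on $\alpha$ and the constant in $|h(d)|\ll d^\alpha$). *)

theory Defs
  imports "HOL-Analysis.Analysis"
begin

definition power_supported :: "nat \<Rightarrow> (nat \<Rightarrow> complex) \<Rightarrow> nat \<Rightarrow> complex" where
  "power_supported r h n =
     (if \<exists>d. d \<ge> 1 \<and> n = d ^ r then h (THE d. d \<ge> 1 \<and> n = d ^ r) else 0)"

definition eta_par :: "nat \<Rightarrow> real" where
  "eta_par r = (if odd r then 1 else 0)"

end

theory Submission
  imports Defs
begin

text \<open>
  Grouping by the value $d^r$ of $\lfloor x/n \rfloor$, the sum becomes $\sum_d h(d) N(d)$ with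
  $N(d) = \lfloor x/d^r \rfloor - \lfloor x/(d^r+1) \rfloor = x/(d^r(d^r+1)) + O(1)$. Put
  $s = \lfloor (r-1)/2 \rfloor$, so that $3r + \eta = 2(r+s+1)$. The $O(1)$ errors with
  $d \le D_0 \asymp x^{1/(r+s+1)}$ contribute the stated error term. For $d > D_0$ one has
  $N(d) \in \{0,1\}$, and $N(d) = 1$ forces $x/d^r$ to be within $x/d^{2r}$ of an integer.

  Such $d$ are well spaced. The integral of $(u-d)^s (e-u)^s u^{r-s-1}$ over $[d,e]$ is, up to a
  constant, of the form $e^r P - d^r Q$ with integer forms $P, Q$ of degree $s$ in $(d,e)$ (Hermite's
  form of the Pade approximation to $(1+z)^r$). If $n \approx x/d^r$ and $m \approx x/e^r$ are
  the integers in question and $d, e \in (D, 2D]$, then $Pn - Qm$ is an integer which is, up to a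
  negligible error, of order $x (e-d)^{2s+1} / D^{r+s+1}$. If that is less than $1$ the integer
  vanishes, and since $2s+1 \le r$ this forces $e-d = O(1)$. Hence there are
  $O(x^{1/(2s+1)} D^{-\beta})$ such $d$ in $(D,2D]$, where $\beta = (r-s)/(2s+1)$ is exactly the
  upper limit for $\alpha$, and the dyadic sum over $D \ge D_0$ converges geometrically.
\<close>

section \<open>Hermite's Pade forms for the r-th power\<close>

text \<open>The values at e and d of one antiderivative \<open>G\<close> are
  \<open>e ^ r * P\<close> and \<open>d ^ r * Q\<close>, so the form is an integral over [d,e] of a
  nonnegative function. Both bounds are mean value estimates, the upper one on all of [d,e] and the
  lower one on its middle third. The factor (r+s)! makes the coefficients integral.\<close>

lemma hermite_form:
  fixes r s :: nat
  assumes rs: "2 * s + 1 \<le> r"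
  obtains P Q :: "nat \<Rightarrow> nat \<Rightarrow> int" and C c B :: real
  where "C > 0" "c > 0" "B > 0"
    "\<And>d e. d < e \<Longrightarrow> \<bar>real_of_int (P d e)\<bar> \<le> C * real e ^ s"
    "\<And>d e. d < e \<Longrightarrow> \<bar>real_of_int (Q d e)\<bar> \<le> C * real e ^ s"
    "\<And>d e. d < e \<Longrightarrow> c * (real e - real d) ^ (2 * s + 1) * real d ^ (r-s-1)
       \<le> real e ^ r * of_int (P d e) - real d ^ r * of_int (Q d e)"
    "\<And>d e. d < e \<Longrightarrow> real e ^ r * of_int (P d e) - real d ^ r * of_int (Q d e)
       \<le> B * (real e - real d) ^ (2 * s + 1) * real e ^ (r-s-1)"
proof -
  \<comment> \<open>The integer division is exact: i+k+(r-s) lies between r-s > 0 and r+s, hence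
    divides (r+s)!.\<close>
  define w :: "nat \<Rightarrow> nat \<Rightarrow> int" where "w = (\<lambda>i k. (-1) ^ (s-i) * (-1) ^ k *
     int (s choose i) * int (s choose k) * (fact (r+s) div int (i+k+(r-s))))"
  define P where "P = (\<lambda>d e::nat. \<Sum>i\<le>s. \<Sum>k\<le>s. w i k * int d ^ (s-i) * int e ^ i)"
  define Q where "Q = (\<lambda>d e::nat. \<Sum>i\<le>s. \<Sum>k\<le>s. w i k * int d ^ k * int e ^ (s-k))"
  \<comment> \<open>The summand 1 gives positivity without inspecting the coefficients.\<close>
  define C where "C = 1 + (\<Sum>i\<le>s. \<Sum>k\<le>s. \<bar>real_of_int (w i k)\<bar>)"
  define F where "F = (fact (r+s) :: real)"
  have F: "F > 0" by (simp add: F_def)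
  \<comment> \<open>the antiderivative of \<open>F * (u - d) ^ s * (e - u) ^ s * u ^ (r - s - 1)\<close>\<close>
  define G where "G = (\<lambda>(d::nat) (e::nat) (u::real). \<Sum>i\<le>s. \<Sum>k\<le>s.
      real_of_int (w i k) * real d ^ (s-i) * real e ^ (s-k) * u ^ (i+k+(r-s)))"
  have w: "real_of_int (w i k) * real (i+k+(r-s)) =
      F * ((-1) ^ (s-i) * (-1) ^ k * real (s choose i) * real (s choose k))"
    if "i \<le> s" "k \<le> s" for i k
  proof -
    have "(i+k+(r-s)) dvd (fact (r+s) :: nat)"
      using that rs by (intro dvd_fact) auto
    hence "int (i+k+(r-s)) dvd int (fact (r+s))" by (simp only: int_dvd_int_iff)
    hence "int (i+k+(r-s)) dvd fact (r+s)" by simp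
    hence "(fact (r+s) div int (i+k+(r-s))) * int (i+k+(r-s)) = fact (r+s)"
      by (rule dvd_div_mult_self)
    hence "real_of_int ((fact (r+s) div int (i+k+(r-s))) * int (i+k+(r-s))) = F"
      by (simp add: F_def)
    hence *: "real_of_int (fact (r+s) div int (i+k+(r-s))) * real (i+k+(r-s)) = F"
      by (simp only: of_int_mult of_int_of_nat_eq)
    have "real_of_int (w i k) * real (i+k+(r-s)) = ((-1) ^ (s-i) * (-1) ^ k * real (s choose i) * real (s choose k)) *
       (real_of_int (fact (r+s) div int (i+k+(r-s))) * real (i+k+(r-s)))"
      unfolding w_def by simp
    thus ?thesis unfolding * by simp
  qed
  \<comment> \<open>At u = e the powers of e have total exponent r+i, so e^r splits off and an
    integer form of degree s remains. At u = d the powers of d have total exponent r+k.\<close>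
  have G_e: "G d e (real e) = real e ^ r * of_int (P d e)" for d e
    unfolding G_def P_def of_int_sum sum_distrib_left
  proof (intro sum.cong refl)
    fix i k assume "i \<in> {..s}" "k \<in> {..s}"
    hence "s - k + (i+k+(r-s)) = r + i" using rs by auto
    hence "real e ^ (s-k) * real e ^ (i+k+(r-s)) = real e ^ r * real e ^ i"
      by (simp only: power_add [symmetric])
    thus "real_of_int (w i k) * real d ^ (s-i) * real e ^ (s-k) * real e ^ (i+k+(r-s))
        = real e ^ r * real_of_int (w i k * int d ^ (s - i) * int e ^ i)"
      by (simp add: mult_ac)
  qed
  have G_d: "G d e (real d) = real d ^ r * of_int (Q d e)" for d e
    unfolding G_def Q_def of_int_sum sum_distrib_left
  proof (intro sum.cong refl)
    fix i k assume "i \<in> {..s}" "k \<in> {..s}"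
    hence "s - i + (i+k+(r-s)) = r + k" using rs by auto
    hence "real d ^ (s-i) * real d ^ (i+k+(r-s)) = real d ^ r * real d ^ k"
      by (simp only: power_add [symmetric])
    thus "real_of_int (w i k) * real d ^ (s-i) * real e ^ (s-k) * real d ^ (i+k+(r-s))
        = real d ^ r * real_of_int (w i k * int d ^ k * int e ^ (s - k))"
      by (simp add: mult_ac)
  qed
  define g where "g = (\<lambda>(d::nat) (e::nat) (u::real). F * ((u - real d) ^ s * (real e - u) ^ s * u ^ (r-s-1)))"
  \<comment> \<open>Differentiating termwise cancels the denominators i+k+(r-s) inside
    \<open>w\<close>; what is left is the product of two binomial expansions.\<close>
  have g_expand: "(\<Sum>i\<le>s. \<Sum>k\<le>s. real_of_int (w i k) * real d ^ (s-i) * real e ^ (s-k) *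
         (real (i+k+(r-s)) * u ^ (i+k+(r-s)-1))) = g d e u" for d e u
  proof -
    have 1: "(u - real d) ^ s = (\<Sum>i\<le>s. real (s choose i) * u ^ i * (- real d) ^ (s-i))"
      using binomial_ring [of u "- real d" s] by simp
    have 2: "(real e - u) ^ s = (\<Sum>k\<le>s. real (s choose k) * (-u) ^ k * real e ^ (s-k))"
      using binomial_ring [of "-u" "real e" s] by simp
    show ?thesis
      unfolding g_def 1 2 sum_product unfolding sum_distrib_right sum_distrib_left
    proof (intro sum.cong refl)
      fix i k assume ik: "i \<in> {..s}" "k \<in> {..s}"
      hence "i+k+(r-s)-1 = i + k + (r-s-1)" using rs by auto
      hence u: "u ^ (i+k+(r-s)-1) = u ^ i * u ^ k * u ^ (r-s-1)"
        by (simp only: power_add)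
      have "real_of_int (w i k) * real d ^ (s-i) * real e ^ (s-k) * (real (i+k+(r-s)) * u ^ (i+k+(r-s)-1))
        = (real_of_int (w i k) * real (i+k+(r-s))) * real d ^ (s-i) * real e ^ (s-k) * (u ^ i * u ^ k * u ^ (r-s-1))"
        unfolding u by (simp only: mult_ac)
      also have "\<dots> = F * (real (s choose i) * u ^ i * (- real d) ^ (s - i) *
              (real (s choose k) * (- u) ^ k * real e ^ (s - k)) * u ^ (r - s - 1))"
        using ik unfolding power_minus [of "real d"] power_minus [of u] by (subst w) (auto simp: mult_ac)
      finally show "real_of_int (w i k) * real d ^ (s-i) * real e ^ (s-k) *
              (real (i+k+(r-s)) * u ^ (i+k+(r-s)-1)) = \<dots>" .
    qed
  qed
  have deriv: "(G d e has_real_derivative g d e u) (at u)" for d e u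
    unfolding g_expand [symmetric] unfolding G_def
    by (auto intro!: derivative_eq_intros sum.cong)
  have g_nonneg: "g d e u \<ge> 0" if "real d \<le> u" "u \<le> real e" for d e u
    using that F unfolding g_def by (intro mult_nonneg_nonneg zero_le_power) auto
  show thesis
  proof (rule that)
    show "C > 0" unfolding C_def by (smt (verit) sum_nonneg abs_ge_zero)
    show "F * (1/3) ^ (2 * s + 1) > 0" "F > 0" using F by auto
    fix d e :: nat assume de: "d < e"
    have mono: "real d ^ i * real e ^ j \<le> real e ^ s" if "i + j = s" for i j
    proof -
      have "real d ^ i * real e ^ j \<le> real e ^ i * real e ^ j"
        using de by (intro mult_right_mono power_mono) auto
      thus ?thesis using that by (simp add: power_add [symmetric])
    qed
    show "\<bar>real_of_int (P d e)\<bar> \<le> C * real e ^ s"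
    proof -
      have "\<bar>real_of_int (P d e)\<bar> \<le> (\<Sum>i\<le>s. \<Sum>k\<le>s. \<bar>real_of_int (w i k)\<bar> * real e ^ s)"
        unfolding P_def of_int_sum
      proof (intro order_trans [OF sum_abs] sum_mono)
        fix i k assume ik: "i \<in> {..s}" "k \<in> {..s}"
        have "\<bar>real_of_int (w i k * int d ^ (s - i) * int e ^ i)\<bar> = \<bar>real_of_int (w i k)\<bar> * (real d ^ (s-i) * real e ^ i)"
          by (simp add: abs_mult)
        also have "\<dots> \<le> \<bar>real_of_int (w i k)\<bar> * real e ^ s"
          using ik by (intro mult_left_mono mono) auto
        finally show "\<bar>real_of_int (w i k * int d ^ (s - i) * int e ^ i)\<bar> \<le> \<dots>" .
      qed
      also have "\<dots> \<le> C * real e ^ s"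
        unfolding C_def distrib_right sum_distrib_right by simp
      finally show ?thesis .
    qed
    show "\<bar>real_of_int (Q d e)\<bar> \<le> C * real e ^ s"
    proof -
      have "\<bar>real_of_int (Q d e)\<bar> \<le> (\<Sum>i\<le>s. \<Sum>k\<le>s. \<bar>real_of_int (w i k)\<bar> * real e ^ s)"
        unfolding Q_def of_int_sum
      proof (intro order_trans [OF sum_abs] sum_mono)
        fix i k assume ik: "i \<in> {..s}" "k \<in> {..s}"
        have "\<bar>real_of_int (w i k * int d ^ k * int e ^ (s - k))\<bar> = \<bar>real_of_int (w i k)\<bar> * (real d ^ k * real e ^ (s-k))"
          by (simp add: abs_mult)
        also have "\<dots> \<le> \<bar>real_of_int (w i k)\<bar> * real e ^ s"
          using ik by (intro mult_left_mono mono) auto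
        finally show "\<bar>real_of_int (w i k * int d ^ k * int e ^ (s - k))\<bar> \<le> \<dots>" .
      qed
      also have "\<dots> \<le> C * real e ^ s"
        unfolding C_def distrib_right sum_distrib_right by simp
      finally show ?thesis .
    qed
    define a where "a = real e - real d"
    have a: "a > 0" using de by (simp add: a_def)
    have mono_G: "G d e u \<le> G d e v" if "real d \<le> u" "u \<le> v" "v \<le> real e" for u v
    proof (rule DERIV_nonneg_imp_nondecreasing [of u v "G d e"])
      fix y assume "u \<le> y" "y \<le> v"
      hence "(G d e has_real_derivative g d e y) (at y) \<and> 0 \<le> g d e y"
        using that deriv g_nonneg by simp
      thus "\<exists>z. (G d e has_real_derivative z) (at y) \<and> 0 \<le> z" ..
    qed (use that in simp)
    obtain z where z: "z > real d" "z < real e" "G d e (real e) - G d e (real d) = a * g d e z"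
      using MVT2 [of "real d" "real e" "G d e" "g d e"] de deriv unfolding a_def by auto
    have "g d e z \<le> F * (a ^ s * a ^ s * real e ^ (r-s-1))"
      unfolding g_def using z F by (intro mult_left_mono mult_mono power_mono) (auto simp: a_def)
    hence "a * g d e z \<le> a * (F * (a ^ s * a ^ s * real e ^ (r-s-1)))"
      using a by (intro mult_left_mono) auto
    also have "\<dots> = F * a ^ (2 * s + 1) * real e ^ (r-s-1)"
      by (simp add: power_add mult_2)
    finally show "real e ^ r * of_int (P d e) - real d ^ r * of_int (Q d e)
       \<le> F * (real e - real d) ^ (2 * s + 1) * real e ^ (r-s-1)"
      using z(3) by (simp add: G_d G_e a_def)
    \<comment> \<open>on the middle third both \<open>u - d\<close> and \<open>e - u\<close> are at least \<open>a/3\<close>\<close>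
    have len: "(real e - a/3) - (real d + a/3) = a/3" unfolding a_def by (simp add: field_simps)
    hence "real d + a/3 < real e - a/3" using a by linarith
    then obtain y where y: "y > real d + a/3" "y < real e - a/3"
        "G d e (real e - a/3) - G d e (real d + a/3) = (a/3) * g d e y"
      using MVT2 [of "real d + a/3" "real e - a/3" "G d e" "g d e"] deriv unfolding len by blast
    have "F * (1/3) ^ (2 * s + 1) * a ^ (2 * s + 1) * real d ^ (r-s-1)
        = (a/3) * (F * ((a/3) ^ s * (a/3) ^ s * real d ^ (r-s-1)))"
      by (simp add: power_add mult_2 power_divide)
    also have "\<dots> \<le> (a/3) * g d e y"
      unfolding g_def using y F a by (intro mult_left_mono mult_mono power_mono) auto
    also have "\<dots> \<le> G d e (real e) - G d e (real d)"
      using mono_G [of "real d" "real d + a/3"] mono_G [of "real e - a/3" "real e"] y(3) a len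
      by linarith
    finally show "F * (1/3) ^ (2 * s + 1) * (real e - real d) ^ (2 * s + 1) * real d ^ (r-s-1)
       \<le> real e ^ r * of_int (P d e) - real d ^ r * of_int (Q d e)"
      by (simp add: G_d G_e a_def)
  qed
qed

section \<open>Counting clusters and summing over dyadic blocks\<close>

text \<open>Cut (D,2D] into at most D/L + 1 blocks of length L. Two elements of one block are closer
  than L, so all lie within A of the least one, and a block holds at most A+1 elements.\<close>

lemma card_clustered_le:
  fixes T :: "nat set" and D L :: real
  assumes L: "L > 0" and D: "D \<ge> 0" and fin: "finite T"
    and T: "\<And>d. d \<in> T \<Longrightarrow> D < real d \<and> real d \<le> 2 * D"
    and close: "\<And>d e. d \<in> T \<Longrightarrow> e \<in> T \<Longrightarrow> d < e \<Longrightarrow> real e - real d < L \<Longrightarrow> e - d \<le> A"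
  shows "real (card T) \<le> real (A + 1) * (D / L + 1)"
proof -
  define \<phi> where "\<phi> = (\<lambda>d::nat. nat \<lfloor>(real d - D) / L\<rfloor>)"
  define J where "J = nat \<lfloor>D / L\<rfloor>"
  define U where "U = (\<lambda>j. {d \<in> T. \<phi> d = j})"
  have "\<phi> d \<le> J" if "d \<in> T" for d
    unfolding \<phi>_def J_def using T [OF that] L
    by (intro nat_mono floor_mono divide_right_mono) auto
  hence "T \<subseteq> (\<Union>j\<in>{..J}. U j)" by (auto simp: U_def)
  hence "card T \<le> card (\<Union>j\<in>{..J}. U j)"
    using fin by (intro card_mono) (auto simp: U_def)
  also have "\<dots> \<le> (\<Sum>j\<in>{..J}. card (U j))" by (rule card_UN_le) auto
  also have "\<dots> \<le> (\<Sum>j\<in>{..J}. A + 1)"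
  proof (rule sum_mono)
    fix j
    show "card (U j) \<le> A + 1"
    proof (cases "U j = {}")
      case False
      have finU: "finite (U j)" using fin by (auto simp: U_def)
      define m where "m = Min (U j)"
      have m: "m \<in> U j" "\<And>d. d \<in> U j \<Longrightarrow> m \<le> d"
        using False finU by (auto simp: m_def)
      have "U j \<subseteq> {m..m+A}"
      proof
        fix d assume d: "d \<in> U j"
        have "\<lfloor>(real d - D) / L\<rfloor> = \<lfloor>(real m - D) / L\<rfloor>"
        proof -
          have "0 \<le> \<lfloor>(real d - D) / L\<rfloor>" "0 \<le> \<lfloor>(real m - D) / L\<rfloor>"
            using d m(1) T [of d] T [of m] L by (auto simp: U_def)
          moreover have "nat \<lfloor>(real d - D) / L\<rfloor> = nat \<lfloor>(real m - D) / L\<rfloor>"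
            using d m(1) by (auto simp: U_def \<phi>_def)
          ultimately show ?thesis by (simp only: eq_nat_nat_iff)
        qed
        hence "(real d - D) / L - (real m - D) / L < 1" by linarith
        hence "real d - real m < L" using L by (simp add: field_simps)
        thus "d \<in> {m..m+A}"
          using close [of m d] d m(1) m(2)[OF d] by (cases "m = d") (auto simp: U_def)
      qed
      hence "card (U j) \<le> card {m..m+A}" by (intro card_mono) auto
      thus ?thesis by simp
    qed auto
  qed
  also have "\<dots> = (A + 1) * (J + 1)" by simp
  finally have "real (card T) \<le> real ((A + 1) * (J + 1))" by (simp only: of_nat_le_iff)
  also have "\<dots> = real (A + 1) * (real J + 1)" by (simp add: algebra_simps)
  also have "\<dots> \<le> real (A + 1) * (D / L + 1)"
    using L D unfolding J_def by (intro mult_left_mono) auto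
  finally show ?thesis .
qed

text \<open>The block (E,2E] contributes at most a constant times E^(\<gamma>-\<beta>). For E = 2^j
  D these bounds form a geometric series of ratio 2^(\<gamma>-\<beta>) < 1. The lemma serves both
  for the sparse set of quotients and, with \<beta> = -1, for all integers beyond D.\<close>

lemma sum_powr_dyadic_le:
  fixes T :: "nat set" and B D \<gamma> \<beta> :: real
  assumes D: "D > 0" and B: "B \<ge> 0" and fin: "finite T" and \<gamma>: "\<gamma> < \<beta>"
    and T: "\<And>d. d \<in> T \<Longrightarrow> D < real d"
    and count: "\<And>E. E \<ge> D \<Longrightarrow> real (card {d \<in> T. E < real d \<and> real d \<le> 2 * E}) \<le> B * E powr (-\<beta>)"
  shows "(\<Sum>d\<in>T. real d powr \<gamma>) \<le> B * 2 powr \<bar>\<gamma>\<bar> * D powr (\<gamma> - \<beta>) / (1 - 2 powr (\<gamma> - \<beta>))"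
proof -
  define q where "q = (2::real) powr (\<gamma> - \<beta>)"
  have q: "0 < q" "q < 1" using \<gamma> unfolding q_def by (auto simp: powr_less_one)
  define c where "c = B * 2 powr \<bar>\<gamma>\<bar> * D powr (\<gamma> - \<beta>)"
  have c: "c \<ge> 0" using B by (simp add: c_def)
  have block: "(\<Sum>d\<in>{d\<in>T. E < real d \<and> real d \<le> 2 * E}. real d powr \<gamma>) \<le> B * 2 powr \<bar>\<gamma>\<bar> * E powr (\<gamma> - \<beta>)"
    if E: "E \<ge> D" for E
  proof -
    have E0: "E > 0" using E D by simp
    have "(\<Sum>d\<in>{d\<in>T. E < real d \<and> real d \<le> 2 * E}. real d powr \<gamma>)
        \<le> (\<Sum>d\<in>{d\<in>T. E < real d \<and> real d \<le> 2 * E}. 2 powr \<bar>\<gamma>\<bar> * E powr \<gamma>)"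
    proof (rule sum_mono)
      fix d assume "d \<in> {d\<in>T. E < real d \<and> real d \<le> 2 * E}"
      hence d: "E < real d" "real d \<le> 2 * E" by auto
      \<comment> \<open>On (E,2E] the power is largest at 2E or at E according to the sign of the
        exponent; the factor with the absolute value covers both cases.\<close>
      show "real d powr \<gamma> \<le> 2 powr \<bar>\<gamma>\<bar> * E powr \<gamma>"
      proof (cases "\<gamma> \<ge> 0")
        case True
        have "real d powr \<gamma> \<le> (2 * E) powr \<gamma>" using d E0 True by (intro powr_mono2) auto
        thus ?thesis using True E0 by (simp add: powr_mult)
      next
        case False
        have "real d powr \<gamma> \<le> E powr \<gamma>" using d E0 False by (intro powr_mono2') auto
        also have "\<dots> \<le> 2 powr \<bar>\<gamma>\<bar> * E powr \<gamma>"
          using ge_one_powr_ge_zero [of 2 "\<bar>\<gamma>\<bar>"] mult_right_mono [of 1 "2 powr \<bar>\<gamma>\<bar>" "E powr \<gamma>"] by simp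
        finally show ?thesis .
      qed
    qed
    also have "\<dots> = real (card {d\<in>T. E < real d \<and> real d \<le> 2 * E}) * (2 powr \<bar>\<gamma>\<bar> * E powr \<gamma>)" by simp
    also have "\<dots> \<le> B * E powr (-\<beta>) * (2 powr \<bar>\<gamma>\<bar> * E powr \<gamma>)"
      using count [OF E] by (intro mult_right_mono) auto
    also have "\<dots> = B * 2 powr \<bar>\<gamma>\<bar> * E powr (\<gamma> - \<beta>)"
      using E0 by (simp add: powr_diff powr_minus field_simps)
    finally show ?thesis .
  qed
  have step: "(\<Sum>d\<in>{d\<in>T. real d \<le> 2 ^ J * D}. real d powr \<gamma>) \<le> c * (\<Sum>j<J. q ^ j)" for J
  proof (induction J)
    case 0
    have "{d\<in>T. real d \<le> 2 ^ 0 * D} = {}" using T by force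
    thus ?case by (simp only:) simp
  next
    case (Suc J)
    define E where "E = 2 ^ J * D"
    have E: "E \<ge> D" using D one_le_power [of "2::real" J] by (simp add: E_def)
    have split: "{d\<in>T. real d \<le> 2 ^ Suc J * D} =
        {d\<in>T. real d \<le> 2 ^ J * D} \<union> {d\<in>T. E < real d \<and> real d \<le> 2 * E}"
      using D E by (auto simp: E_def)
    have "E powr (\<gamma> - \<beta>) = q ^ J * D powr (\<gamma> - \<beta>)"
    proof -
      have "((2::real) ^ J) powr (\<gamma> - \<beta>) = q ^ J"
        unfolding q_def by (simp add: powr_realpow [symmetric] powr_powr mult.commute)
      thus ?thesis using D by (simp add: E_def powr_mult)
    qed
    hence "(\<Sum>d\<in>{d\<in>T. E < real d \<and> real d \<le> 2 * E}. real d powr \<gamma>) \<le> c * q ^ J"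
      using block [OF E] by (simp add: c_def mult_ac)
    moreover have "(\<Sum>d\<in>{d\<in>T. real d \<le> 2 ^ Suc J * D}. real d powr \<gamma>) =
      (\<Sum>d\<in>{d\<in>T. real d \<le> 2 ^ J * D}. real d powr \<gamma>) + (\<Sum>d\<in>{d\<in>T. E < real d \<and> real d \<le> 2 * E}. real d powr \<gamma>)"
      unfolding split using fin by (intro sum.union_disjoint) (auto simp: E_def)
    ultimately show ?case using Suc.IH by (simp add: distrib_left)
  qed
  \<comment> \<open>Inserting 0 keeps \<open>Max\<close> meaningful when \<open>T\<close> is
    empty.\<close>
  obtain J where J: "real (Max (insert 0 T)) / D < 2 ^ J"
    using real_arch_pow [of 2] by auto
  have "real d \<le> 2 ^ J * D" if "d \<in> T" for d
  proof -
    have "real d \<le> real (Max (insert 0 T))" using that fin by auto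
    also have "\<dots> \<le> 2 ^ J * D" using J D by (simp add: field_simps)
    finally show ?thesis .
  qed
  hence "{d\<in>T. real d \<le> 2 ^ J * D} = T" by auto
  hence "(\<Sum>d\<in>T. real d powr \<gamma>) \<le> c * (\<Sum>j<J. q ^ j)" using step [of J] by simp
  also have "\<dots> \<le> c * (1 / (1 - q))"
  proof (intro mult_left_mono c)
    have "(\<Sum>j<J. q ^ j) = (1 - q ^ J) / (1 - q)"
      using q by (subst sum_gp_strict) auto
    also have "\<dots> \<le> 1 / (1 - q)" using q by (intro divide_right_mono) auto
    finally show "(\<Sum>j<J. q ^ j) \<le> 1 / (1 - q)" .
  qed
  finally show ?thesis by (simp add: c_def q_def)
qed

section \<open>Spacing of the d whose r-th power is a quotient\<close>

text \<open>The \<open>d \<ge> 1\<close> such that \<open>d ^ r = \<lfloor>x / n\<rfloor>\<close> for some \<open>n\<close>.\<close>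

definition power_quotients :: "nat \<Rightarrow> real \<Rightarrow> nat set" where
  "power_quotients r x =
     {d. d \<ge> 1 \<and> (\<exists>n::nat. real d ^ r * real n \<le> x \<and> x < (real d ^ r + 1) * real n)}"

lemma power_quotients_le:
  assumes "d \<in> power_quotients r x" "x \<ge> 0"
  shows "real d ^ r \<le> x"
proof -
  from assms obtain n :: nat where n: "real d ^ r * real n \<le> x" "x < (real d ^ r + 1) * real n"
    by (auto simp: power_quotients_def)
  have "n \<noteq> 0" using n assms(2) by (cases n) auto
  hence "real d ^ r * 1 \<le> real d ^ r * real n" by (intro mult_left_mono) auto
  with n show ?thesis by simp
qed

text \<open>From d^r n \<le> x < d^r n + n, the distance from n to x/d^r is less than n/d^r, and n
  \<le> x/d^r.\<close>

lemma power_quotients_approx: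
  assumes "d \<in> power_quotients r x" "x \<ge> 0"
  obtains n :: int where "0 \<le> x / real d ^ r - of_int n" "x / real d ^ r - of_int n \<le> x / real d ^ (2 * r)"
proof -
  from assms obtain n :: nat where n: "real d ^ r * real n \<le> x" "x < (real d ^ r + 1) * real n"
    and d: "d \<ge> 1" by (auto simp: power_quotients_def)
  have dr: "real d ^ r > 0" using d by simp
  have "real n \<le> x / real d ^ r" using n dr by (simp add: field_simps)
  moreover have "x / real d ^ r - real n \<le> x / real d ^ (2 * r)"
  proof -
    have "x / real d ^ r - real n = (x - real d ^ r * real n) / real d ^ r"
      using dr by (simp add: field_simps)
    also have "\<dots> \<le> (x / real d ^ r) / real d ^ r"
      using dr n \<open>real n \<le> _\<close> by (intro divide_right_mono) (auto simp: algebra_simps)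
    also have "\<dots> = x / real d ^ (2 * r)" by (simp add: power_add mult_2)
    finally show ?thesis .
  qed
  ultimately show thesis by (intro that [of "int n"]) auto
qed

text \<open>Replacing x/d^r and x/e^r by the nearby integers n and m turns \<open>main\<close> into
  the integer Pn - Qm plus an error. \<open>K0\<close> makes the error small and \<open>M\<close>
  makes \<open>main\<close> small, so the integer is 0. Then \<open>main\<close> is no larger than
  the error, and its lower bound limits e - d independently of x and D.\<close>

lemma power_quotients_gap:
  fixes r s :: nat
  assumes rs: "2 * s + 1 \<le> r"
  obtains K0 M :: real and A :: nat
  where "K0 \<ge> 1" "M \<ge> 1"
    "\<And>x D d e. x \<ge> 1 \<Longrightarrow> D \<ge> 1 \<Longrightarrow> K0 * x \<le> D ^ (r + s + 1) \<Longrightarrow> d < e \<Longrightarrow>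
       D < real d \<Longrightarrow> real e \<le> 2 * D \<Longrightarrow> d \<in> power_quotients r x \<Longrightarrow> e \<in> power_quotients r x \<Longrightarrow>
       M * x * (real e - real d) ^ (2 * s + 1) < D ^ (r + s + 1) \<Longrightarrow> e - d \<le> A"
proof -
  obtain P Q :: "nat \<Rightarrow> nat \<Rightarrow> int" and C c B :: real
    where pos: "C > 0" "c > 0" "B > 0"
    and P: "\<And>d e. d < e \<Longrightarrow> \<bar>real_of_int (P d e)\<bar> \<le> C * real e ^ s"
    and Q: "\<And>d e. d < e \<Longrightarrow> \<bar>real_of_int (Q d e)\<bar> \<le> C * real e ^ s"
    and lo: "\<And>d e. d < e \<Longrightarrow> c * (real e - real d) ^ (2 * s + 1) * real d ^ (r-s-1)
       \<le> real e ^ r * of_int (P d e) - real d ^ r * of_int (Q d e)"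
    and hi: "\<And>d e. d < e \<Longrightarrow> real e ^ r * of_int (P d e) - real d ^ r * of_int (Q d e)
       \<le> B * (real e - real d) ^ (2 * s + 1) * real e ^ (r-s-1)"
    using hermite_form [OF rs] by metis
  define C2 where "C2 = 2 * C * 2 ^ s"
  define A where "A = nat \<lceil>C2 * 2 ^ (r + s + 1) / c\<rceil>"
  have C2: "C2 > 0" using pos by (simp add: C2_def)
  show thesis
  \<comment> \<open>The factor 2 brings the error and the main term below 1/2 each; the added 1
    makes both constants at least 1 and the estimate of the error strict.\<close>
  proof (rule that [of "2 * C2 + 1" "2 * B + 1" A])
    show "2 * C2 + 1 \<ge> 1" "2 * B + 1 \<ge> 1" using C2 pos by auto
    fix x D :: real and d e :: nat
    assume x: "x \<ge> 1" and D: "D \<ge> 1" and KD: "(2 * C2 + 1) * x \<le> D ^ (r + s + 1)"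
      and de: "d < e" and dD: "D < real d" and eD: "real e \<le> 2 * D"
      and dS: "d \<in> power_quotients r x" and eS: "e \<in> power_quotients r x"
      and small: "(2 * B + 1) * x * (real e - real d) ^ (2 * s + 1) < D ^ (r + s + 1)"
    define a where "a = real e - real d"
    have a: "a > 0" using de by (simp add: a_def)
    have d0: "real d > 0" and e0: "real e > 0" and eD': "D < real e" using dD D de by linarith+
    obtain n :: int where n: "0 \<le> x / real d ^ r - of_int n" "x / real d ^ r - of_int n \<le> x / real d ^ (2 * r)"
      using power_quotients_approx [OF dS] x by auto
    obtain m :: int where m: "0 \<le> x / real e ^ r - of_int m" "x / real e ^ r - of_int m \<le> x / real e ^ (2 * r)"
      using power_quotients_approx [OF eS] x by auto
    define \<rho> where "\<rho> = x / real d ^ r - of_int n"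
    define \<sigma> where "\<sigma> = x / real e ^ r - of_int m"
    define p where "p = real_of_int (P d e)"
    define q where "q = real_of_int (Q d e)"
    \<comment> \<open>This is P x/d^r - Q x/e^r over a common denominator, the shape to which the
      two bounds on the Hermite form apply.\<close>
    define main where "main = x * (real e ^ r * p - real d ^ r * q) / (real d ^ r * real e ^ r)"
    have D2r: "D ^ (2 * r) > 0" using D by simp
    have "x / real d ^ (2 * r) \<le> x / D ^ (2 * r)"
      using x D dD by (intro divide_left_mono power_mono) auto
    hence \<rho>: "\<bar>\<rho>\<bar> \<le> x / D ^ (2 * r)" using n by (simp add: \<rho>_def)
    have "x / real e ^ (2 * r) \<le> x / D ^ (2 * r)"
      using x D eD' by (intro divide_left_mono power_mono) auto
    hence \<sigma>: "\<bar>\<sigma>\<bar> \<le> x / D ^ (2 * r)" using m by (simp add: \<sigma>_def)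
    have main_eq: "main = of_int (P d e * n - Q d e * m) + (p * \<rho> - q * \<sigma>)"
    proof -
      have "main = p * (x / real d ^ r) - q * (x / real e ^ r)"
        unfolding main_def using d0 e0 by (simp add: field_simps)
      also have "\<dots> = p * (of_int n + \<rho>) - q * (of_int m + \<sigma>)" by (simp add: \<rho>_def \<sigma>_def)
      finally show ?thesis by (simp add: p_def q_def algebra_simps)
    qed
    have es: "real e ^ s \<le> 2 ^ s * D ^ s"
      using power_mono [OF eD, of s] by (simp add: power_mult_distrib)
    have err: "\<bar>p * \<rho> - q * \<sigma>\<bar> \<le> C2 * D ^ s * x / D ^ (2 * r)"
    proof -
      have pb: "\<bar>p\<bar> \<le> C * (2 ^ s * D ^ s)" "\<bar>q\<bar> \<le> C * (2 ^ s * D ^ s)"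
        unfolding p_def q_def using P [OF de] Q [OF de] mult_left_mono [OF es, of C] pos by linarith+
      have "\<bar>p * \<rho> - q * \<sigma>\<bar> \<le> \<bar>p\<bar> * \<bar>\<rho>\<bar> + \<bar>q\<bar> * \<bar>\<sigma>\<bar>"
        by (metis abs_mult abs_triangle_ineq4)
      also have "\<dots> \<le> C * (2 ^ s * D ^ s) * (x / D ^ (2 * r)) + C * (2 ^ s * D ^ s) * (x / D ^ (2 * r))"
        using pb \<rho> \<sigma> pos D by (intro add_mono mult_mono) auto
      also have "\<dots> = C2 * D ^ s * x / D ^ (2 * r)" by (simp add: C2_def)
      finally show ?thesis .
    qed
    \<comment> \<open>The hypothesis 2s+1 \<le> r enters as r+2s+1 \<le> 2r.\<close>
    have err_half: "C2 * D ^ s * x / D ^ (2 * r) < 1 / 2"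
    proof -
      have "(2 * C2 + 1) * x * D ^ s \<le> D ^ (r + s + 1) * D ^ s"
        using KD D by (intro mult_right_mono) auto
      also have "\<dots> = D ^ (r + 2 * s + 1)" by (simp add: power_add mult_2)
      also have "\<dots> \<le> D ^ (2 * r)" using D rs by (intro power_increasing) auto
      finally have "2 * (C2 * D ^ s * x) + x * D ^ s \<le> D ^ (2 * r)" by (simp add: algebra_simps)
      moreover have "x * D ^ s > 0" using x D by simp
      ultimately show ?thesis using D2r by (simp add: field_simps)
    qed
    \<comment> \<open>The factor d^(r-s-1) of the lower bound cancels against d^r, which leaves the
      denominator d^(s+1) e^r of degree r+s+1. For \<open>main_hi\<close> the same is done with
      e.\<close>
    have main_lo: "x * c * a ^ (2 * s + 1) / (2 * D) ^ (r + s + 1) \<le> main"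
    proof -
      have "real d ^ (s + 1) * real e ^ r \<le> (2 * D) ^ (s + 1) * (2 * D) ^ r"
        using eD de D by (intro mult_mono power_mono) auto
      also have "\<dots> = (2 * D) ^ (r + s + 1)" by (simp add: power_add mult_ac)
      finally have *: "real d ^ (s + 1) * real e ^ r \<le> (2 * D) ^ (r + s + 1)" .
      have dr: "real d ^ r = real d ^ (s + 1) * real d ^ (r-s-1)"
        using rs by (subst power_add [symmetric]) simp
      have "x * c * a ^ (2 * s + 1) / (2 * D) ^ (r + s + 1) \<le> x * c * a ^ (2 * s + 1) / (real d ^ (s + 1) * real e ^ r)"
        using * x pos a d0 e0 D by (intro divide_left_mono mult_pos_pos) auto
      also have "\<dots> = x * (c * a ^ (2 * s + 1) * real d ^ (r-s-1)) / (real d ^ r * real e ^ r)"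
        unfolding dr using d0 e0 by (simp add: field_simps)
      also have "\<dots> \<le> main"
        unfolding main_def p_def q_def a_def using lo [OF de] x d0 e0
        by (intro divide_right_mono mult_left_mono) auto
      finally show ?thesis .
    qed
    have main_hi: "main < 1 / 2"
    proof -
      have er: "real e ^ r = real e ^ (s + 1) * real e ^ (r-s-1)"
        using rs by (subst power_add [symmetric]) simp
      have "main \<le> x * (B * a ^ (2 * s + 1) * real e ^ (r-s-1)) / (real d ^ r * real e ^ r)"
        unfolding main_def p_def q_def a_def using hi [OF de] x d0 e0
        by (intro divide_right_mono mult_left_mono) auto
      also have "\<dots> = B * x * a ^ (2 * s + 1) / (real d ^ r * real e ^ (s + 1))"
        unfolding er using d0 e0 by (simp add: field_simps)
      also have "\<dots> \<le> B * x * a ^ (2 * s + 1) / (D ^ r * D ^ (s + 1))"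
        using dD eD' D x pos a d0 e0
        by (intro divide_left_mono mult_mono power_mono mult_pos_pos) auto
      also have "D ^ r * D ^ (s + 1) = D ^ (r + s + 1)" by (simp add: power_add)
      also have "B * x * a ^ (2 * s + 1) / D ^ (r + s + 1) < 1 / 2"
      proof -
        have "2 * (B * x * a ^ (2 * s + 1)) + x * a ^ (2 * s + 1) < D ^ (r + s + 1)"
          using small by (simp add: a_def algebra_simps)
        moreover have "x * a ^ (2 * s + 1) > 0" using x a by simp
        ultimately show ?thesis using D by (simp add: field_simps)
      qed
      finally show ?thesis .
    qed
    have main_pos: "main \<ge> 0"
      by (rule order_trans [OF _ main_lo]) (use x pos a D in auto)
    have "\<bar>real_of_int (P d e * n - Q d e * m)\<bar> < 1"
      using main_eq main_hi main_pos err err_half by linarith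
    hence "P d e * n - Q d e * m = 0" by linarith
    \<comment> \<open>With the integer gone, \<open>main\<close> equals its error. After cancelling
      x and using r+2s+1 \<le> 2r once more, no x or D remains in the bound for a^(2s+1), and a
      \<ge> 1 passes it on to a.\<close>
    hence "main \<le> C2 * D ^ s * x / D ^ (2 * r)" using main_eq err by simp
    hence "x * c * a ^ (2 * s + 1) / (2 * D) ^ (r + s + 1) \<le> C2 * D ^ s * x / D ^ (2 * r)"
      using main_lo by linarith
    hence "c * a ^ (2 * s + 1) * D ^ (2 * r) * x \<le> C2 * 2 ^ (r + s + 1) * (D ^ s * D ^ (r + s + 1)) * x"
      using D D2r by (simp add: field_simps power_mult_distrib)
    hence "c * a ^ (2 * s + 1) * D ^ (2 * r) \<le> C2 * 2 ^ (r + s + 1) * (D ^ s * D ^ (r + s + 1))"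
      using x by simp
    also have "D ^ s * D ^ (r + s + 1) = D ^ (s + (r + s + 1))" by (simp only: power_add)
    also have "C2 * 2 ^ (r + s + 1) * D ^ (s + (r + s + 1)) \<le> C2 * 2 ^ (r + s + 1) * D ^ (2 * r)"
      using D rs C2 by (intro mult_left_mono power_increasing) auto
    finally have "c * a ^ (2 * s + 1) \<le> C2 * 2 ^ (r + s + 1)" using D2r by simp
    hence "a ^ (2 * s + 1) \<le> C2 * 2 ^ (r + s + 1) / c" using pos by (simp add: field_simps)
    moreover have "a \<ge> 1" using de by (simp add: a_def)
    hence "a ^ 1 \<le> a ^ (2 * s + 1)" by (intro power_increasing) auto
    ultimately have "a ^ 1 \<le> C2 * 2 ^ (r + s + 1) / c" by linarith
    hence "real (e - d) \<le> C2 * 2 ^ (r + s + 1) / c" using de by (simp add: a_def of_nat_diff)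
    thus "e - d \<le> A" unfolding A_def by linarith
  qed
qed

text \<open>The gap lemma gives clusters at every distance below the L with M x L^(2s+1) =
  D^(r+s+1), hence O(D/L + 1) elements. Either D^r > x and there are none, or L \<le> D and the 1 is
  absorbed.\<close>

lemma card_power_quotients_le:
  fixes r s :: nat
  assumes rs: "2 * s + 1 \<le> r"
  obtains K0 C :: real
  where "K0 \<ge> 1" "C \<ge> 0"
    "\<And>x D. x \<ge> 1 \<Longrightarrow> D \<ge> 1 \<Longrightarrow> K0 * x \<le> D ^ (r + s + 1) \<Longrightarrow>
       real (card {d \<in> power_quotients r x. D < real d \<and> real d \<le> 2 * D})
         \<le> C * x powr (1 / real (2 * s + 1)) * D powr (- (real (r - s) / real (2 * s + 1)))"
proof -
  obtain K0 M :: real and A :: nat where K0: "K0 \<ge> 1" and M: "M \<ge> 1"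
    and gap: "\<And>x D d e. x \<ge> 1 \<Longrightarrow> D \<ge> 1 \<Longrightarrow> K0 * x \<le> D ^ (r + s + 1) \<Longrightarrow> d < e \<Longrightarrow>
       D < real d \<Longrightarrow> real e \<le> 2 * D \<Longrightarrow> d \<in> power_quotients r x \<Longrightarrow> e \<in> power_quotients r x \<Longrightarrow>
       M * x * (real e - real d) ^ (2 * s + 1) < D ^ (r + s + 1) \<Longrightarrow> e - d \<le> A"
    using power_quotients_gap [OF rs] by metis
  define t where "t = 1 / real (2 * s + 1)"
  define C where "C = 2 * real (A + 1) * M powr t"
  have C: "C \<ge> 0" by (simp add: C_def)
  show thesis
  proof (rule that [OF K0 C])
    fix x D :: real
    assume x: "x \<ge> 1" and D: "D \<ge> 1" and KD: "K0 * x \<le> D ^ (r + s + 1)"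
    define T where "T = {d \<in> power_quotients r x. D < real d \<and> real d \<le> 2 * D}"
    have fin: "finite T"
    proof (rule finite_subset)
      show "T \<subseteq> {..nat \<lfloor>2 * D\<rfloor>}" by (auto simp: T_def le_nat_iff le_floor_iff)
    qed auto
    have "real (card T) \<le> C * x powr t * D powr (- (real (r - s) * t))"
    proof (cases "D ^ r \<le> x")
      case False
      have "T = {}"
      proof (rule ccontr)
        assume "T \<noteq> {}"
        then obtain d where d: "d \<in> power_quotients r x" "D < real d" by (auto simp: T_def)
        have "D ^ r \<le> real d ^ r" using d D by (intro power_mono) auto
        also have "\<dots> \<le> x" using power_quotients_le [OF d(1)] x by simp
        finally show False using False by simp
      qed
      thus ?thesis using C by simp
    next
      case True
      define L where "L = (D ^ (r + s + 1) / (M * x)) powr t"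
      have base: "D ^ (r + s + 1) / (M * x) > 0" using D M x by simp
      have L: "L > 0" unfolding L_def using base by (subst powr_gt_zero) linarith
      have L_pow: "L ^ (2 * s + 1) = D ^ (r + s + 1) / (M * x)"
      proof -
        have "L ^ (2 * s + 1) = L powr real (2 * s + 1)" by (rule powr_realpow [symmetric, OF L])
        also have "\<dots> = (D ^ (r + s + 1) / (M * x)) powr 1"
          unfolding L_def t_def powr_powr by simp
        also have "\<dots> = D ^ (r + s + 1) / (M * x)" using base by (rule powr_one [OF less_imp_le])
        finally show ?thesis .
      qed
      have "L \<le> D"
      proof (rule power_le_imp_le_base)
        \<comment> \<open>Split r+s+1 as (2s+1) + (r-s) and bound D^(r-s) by D^r \<le> x.\<close>
        have "D ^ (r + s + 1) = D ^ (Suc (2 * s)) * D ^ (r - s)"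
          using rs by (subst power_add [symmetric]) (rule arg_cong [where f = "\<lambda>n. D ^ n"], simp)
        also have "\<dots> \<le> D ^ Suc (2 * s) * D ^ r" using D by (intro mult_left_mono power_increasing) auto
        also have "\<dots> \<le> D ^ Suc (2 * s) * x" using D True by (intro mult_left_mono) auto
        also have "\<dots> \<le> D ^ Suc (2 * s) * (M * x)" using D M x by (intro mult_left_mono) auto
        finally have "D ^ (r + s + 1) / (M * x) \<le> D ^ Suc (2 * s)"
          using M x by (simp add: divide_le_eq)
        thus "L ^ Suc (2 * s) \<le> D ^ Suc (2 * s)" using L_pow by (simp only: Suc_eq_plus1)
      qed (use D in simp)
      have "real (card T) \<le> real (A + 1) * (D / L + 1)"
      proof (rule card_clustered_le [OF L _ fin])
        fix d e assume de: "d \<in> T" "e \<in> T" "d < e" "real e - real d < L"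
        have "(real e - real d) ^ (2 * s + 1) < L ^ (2 * s + 1)"
          using de by (intro power_strict_mono) auto
        hence "M * x * (real e - real d) ^ (2 * s + 1) < D ^ (r + s + 1)"
          unfolding L_pow using M x by (simp add: field_simps)
        thus "e - d \<le> A" using de by (intro gap [OF x D KD]) (auto simp: T_def)
      qed (use D in \<open>auto simp: T_def\<close>)
      also have "\<dots> \<le> real (A + 1) * (D / L + D / L)"
        using L \<open>L \<le> D\<close> by (intro mult_left_mono add_mono) auto
      also have "\<dots> = 2 * real (A + 1) * (D / L)" by simp
      also have "D / L = M powr t * x powr t * D powr (- (real (r - s) * t))"
      proof -
        have "L = (D powr real (r + s + 1) / (M * x)) powr t"
          unfolding L_def using D by (subst powr_realpow) auto
        also have "\<dots> = D powr (real (r + s + 1) * t) / (M powr t * x powr t)"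
          using D M x by (simp add: powr_divide powr_mult powr_powr)
        finally have "D / L = M powr t * x powr t * (D powr 1 / D powr (real (r + s + 1) * t))"
          using D M x by simp
        also have "D powr 1 / D powr (real (r + s + 1) * t) = D powr (1 - real (r + s + 1) * t)"
          by (simp only: powr_diff)
        also have "1 - real (r + s + 1) * t = - (real (r - s) * t)"
          using rs by (simp add: t_def field_simps of_nat_diff)
        finally show ?thesis .
      qed
      finally show ?thesis by (simp add: C_def mult_ac)
    qed
    thus "real (card {d \<in> power_quotients r x. D < real d \<and> real d \<le> 2 * D})
         \<le> C * x powr (1 / real (2 * s + 1)) * D powr (- (real (r - s) / real (2 * s + 1)))"
      unfolding T_def t_def by simp
  qed
qed

text \<open>Insert the count into the dyadic estimate, starting at a multiple of x^(1/(r+s+1)). At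
  that starting point x^t D^(\<alpha>-\<beta>) has the order of D^(1+\<alpha>), the size of the
  trivial bound for the smaller d.\<close>

lemma sum_powr_power_quotients_le:
  fixes r s :: nat and \<alpha> :: real
  assumes rs: "2 * s + 1 \<le> r" and \<alpha>: "\<alpha> < real (r - s) / real (2 * s + 1)"
  obtains K0 C :: real
  where "K0 \<ge> 1" "C \<ge> 0"
    "\<And>x T. x \<ge> 1 \<Longrightarrow> finite T \<Longrightarrow> T \<subseteq> power_quotients r x \<Longrightarrow>
       (\<And>d. d \<in> T \<Longrightarrow> K0 * x powr (1 / real (r + s + 1)) < real d) \<Longrightarrow>
       (\<Sum>d\<in>T. real d powr \<alpha>) \<le> C * x powr ((1 + \<alpha>) / real (r + s + 1))"
proof -
  define k where "k = r + s + 1"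
  have k: "real k > 0" by (simp add: k_def)
  define \<beta> where "\<beta> = real (r - s) / real (2 * s + 1)"
  define t where "t = 1 / real (2 * s + 1)"
  show thesis
  proof (rule card_power_quotients_le [OF rs])
    fix K0 C :: real
    assume K0: "K0 \<ge> 1" and C: "C \<ge> 0"
      and count0: "\<And>x D. x \<ge> 1 \<Longrightarrow> D \<ge> 1 \<Longrightarrow> K0 * x \<le> D ^ (r + s + 1) \<Longrightarrow>
         real (card {d \<in> power_quotients r x. D < real d \<and> real d \<le> 2 * D})
           \<le> C * x powr (1 / real (2 * s + 1)) * D powr (- (real (r - s) / real (2 * s + 1)))"
    note count = count0 [folded k_def t_def \<beta>_def]
    have \<alpha>\<beta>: "\<alpha> < \<beta>" using \<alpha> by (simp add: \<beta>_def)
    define C' where "C' = C * 2 powr \<bar>\<alpha>\<bar> * K0 powr (\<alpha> - \<beta>) / (1 - 2 powr (\<alpha> - \<beta>))"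
    have q: "2 powr (\<alpha> - \<beta>) < 1" using \<alpha>\<beta> by (simp add: powr_less_one)
    have C': "C' \<ge> 0" unfolding C'_def using C q by (intro divide_nonneg_nonneg mult_nonneg_nonneg) auto
    show thesis
    proof (rule that [OF K0 C'])
      fix x :: real and T :: "nat set"
      assume x: "x \<ge> 1" and fin: "finite T" and T: "T \<subseteq> power_quotients r x"
        and big: "\<And>d. d \<in> T \<Longrightarrow> K0 * x powr (1 / real (r + s + 1)) < real d"
      define D where "D = K0 * x powr (1 / real k)"
      have "x powr (1 / real k) \<ge> 1" using x by (intro ge_one_powr_ge_zero) auto
      hence D1: "D \<ge> 1" unfolding D_def using K0 mult_mono [of 1 K0 1 "x powr (1 / real k)"] by simp
      \<comment> \<open>Since K0 \<ge> 1 and k \<ge> 1, K0^k \<ge> K0, so the one constant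
        \<open>K0\<close> also serves as the multiple in D. The condition on D persists for all
        larger E.\<close>
      have Dk: "D ^ k \<ge> K0 * x"
      proof -
        have "(x powr (1 / real k)) ^ k = (x powr (1 / real k)) powr real k"
          using x by (subst powr_realpow) auto
        also have "\<dots> = x" using x k by (simp add: powr_powr)
        finally have "(x powr (1 / real k)) ^ k = x" .
        hence "D ^ k = K0 ^ k * x" by (simp only: D_def power_mult_distrib)
        moreover have "K0 * x \<le> K0 ^ k * x"
          using self_le_power [OF K0, of k] x by (intro mult_right_mono) (auto simp: k_def)
        ultimately show ?thesis by (simp only:)
      qed
      have "(\<Sum>d\<in>T. real d powr \<alpha>) \<le> (C * x powr t) * 2 powr \<bar>\<alpha>\<bar> * D powr (\<alpha> - \<beta>) / (1 - 2 powr (\<alpha> - \<beta>))"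
      proof (rule sum_powr_dyadic_le [OF _ _ fin \<alpha>\<beta>])
        fix E assume E: "E \<ge> D"
        have fin': "finite {d \<in> power_quotients r x. E < real d \<and> real d \<le> 2 * E}"
          by (rule finite_subset [of _ "{..nat \<lfloor>2 * E\<rfloor>}"]) (auto simp: le_nat_iff le_floor_iff)
        have "D ^ k \<le> E ^ k" using E D1 by (intro power_mono) auto
        hence "K0 * x \<le> E ^ k" using Dk by simp
        moreover have "real (card {d \<in> T. E < real d \<and> real d \<le> 2 * E}) \<le>
            real (card {d \<in> power_quotients r x. E < real d \<and> real d \<le> 2 * E})"
          using T fin' by (intro of_nat_mono card_mono) auto
        ultimately show "real (card {d \<in> T. E < real d \<and> real d \<le> 2 * E}) \<le> C * x powr t * E powr (-\<beta>)"
          using count [OF x, of E] E D1 by linarith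
      qed (use D1 C big in \<open>auto simp: D_def k_def\<close>)
      also have "D powr (\<alpha> - \<beta>) = K0 powr (\<alpha> - \<beta>) * x powr ((\<alpha> - \<beta>) / real k)"
        unfolding D_def using K0 x by (simp add: powr_mult powr_powr)
      also have "(C * x powr t) * 2 powr \<bar>\<alpha>\<bar> * (K0 powr (\<alpha> - \<beta>) * x powr ((\<alpha> - \<beta>) / real k)) / (1 - 2 powr (\<alpha> - \<beta>))
          = C' * (x powr t * x powr ((\<alpha> - \<beta>) / real k))"
        by (simp add: C'_def)
      also have "x powr t * x powr ((\<alpha> - \<beta>) / real k) = x powr (t + (\<alpha> - \<beta>) / real k)"
        by (simp only: powr_add)
      also have "t + (\<alpha> - \<beta>) / real k = (1 + \<alpha>) / real k"
      proof -
        have "1 + \<beta> = t * real k"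
          using rs by (simp add: \<beta>_def t_def k_def field_simps of_nat_diff)
        hence "t = (1 + \<beta>) / real k" using k by (simp add: field_simps)
        thus ?thesis by (simp add: add_divide_distrib [symmetric])
      qed
      finally show "(\<Sum>d\<in>T. real d powr \<alpha>) \<le> C' * x powr ((1 + \<alpha>) / real (r + s + 1))"
        by (simp only: k_def)
    qed
  qed
qed

text \<open>The dyadic estimate with \<beta> = -1: a block (E,2E] contains at most 2E
  integers.\<close>

lemma sum_powr_tail_le:
  fixes T :: "nat set" and D \<gamma> :: real
  assumes D: "D \<ge> 1" and \<gamma>: "\<gamma> < -1" and fin: "finite T" and T: "\<And>d. d \<in> T \<Longrightarrow> D < real d"
  shows "(\<Sum>d\<in>T. real d powr \<gamma>) \<le> 2 * 2 powr \<bar>\<gamma>\<bar> * D powr (\<gamma> + 1) / (1 - 2 powr (\<gamma> + 1))"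
proof -
  have "(\<Sum>d\<in>T. real d powr \<gamma>) \<le> 2 * 2 powr \<bar>\<gamma>\<bar> * D powr (\<gamma> - (-1)) / (1 - 2 powr (\<gamma> - (-1)))"
  proof (rule sum_powr_dyadic_le [OF _ _ fin \<gamma>])
    fix E assume E: "E \<ge> D"
    have "card {d \<in> T. E < real d \<and> real d \<le> 2 * E} \<le> card {1..nat \<lfloor>2 * E\<rfloor>}"
    proof (intro card_mono subsetI)
      fix d assume d: "d \<in> {d \<in> T. E < real d \<and> real d \<le> 2 * E}"
      hence "real d > 0" using E D by auto
      thus "d \<in> {1..nat \<lfloor>2 * E\<rfloor>}" using d by (auto simp: le_nat_iff le_floor_iff)
    qed auto
    hence "real (card {d \<in> T. E < real d \<and> real d \<le> 2 * E}) \<le> real (nat \<lfloor>2 * E\<rfloor>)" by simp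
    also have "\<dots> \<le> 2 * E" using E D by auto
    finally show "real (card {d \<in> T. E < real d \<and> real d \<le> 2 * E}) \<le> 2 * E powr (- (-1))"
      using E D by simp
  qed (use D T in auto)
  thus ?thesis by simp
qed

section \<open>From the sum over n to a sum over d\<close>

lemma power_supported_power:
  assumes "r \<ge> 1" "d \<ge> 1"
  shows "power_supported r h (d ^ r) = h d"
proof -
  have "(THE d'. d' \<ge> 1 \<and> d ^ r = d' ^ r) = d"
  proof (rule the_equality)
    fix d' assume "d' \<ge> 1 \<and> d ^ r = d' ^ r"
    thus "d' = d" using assms power_eq_iff_eq_base [of r d d'] by simp
  qed (use assms in simp)
  thus ?thesis using assms unfolding power_supported_def by auto
qed

text \<open>At most one term survives, as r-th powers are injective, and d \<le> d^r keeps the root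
  below Y. This form allows the sums over n and d to be interchanged.\<close>

lemma power_supported_eq_sum:
  assumes r: "r \<ge> 1" and m: "m \<le> Y"
  shows "power_supported r h m = (\<Sum>d\<in>{1..Y}. if m = d ^ r then h d else 0)"
proof (cases "\<exists>d. d \<ge> 1 \<and> m = d ^ r")
  case True
  then obtain d where d: "d \<ge> 1" "m = d ^ r" by auto
  have "d ^ 1 \<le> d ^ r" using d r by (intro power_increasing) auto
  hence dY: "d \<in> {1..Y}" using d m by simp
  have "(m = d' ^ r) = (d' = d)" if "d' \<in> {1..Y}" for d'
    using d r that power_eq_iff_eq_base [of r d d'] by auto
  hence "(\<Sum>d'\<in>{1..Y}. if m = d' ^ r then h d' else 0) = (\<Sum>d'\<in>{1..Y}. if d' = d then h d' else 0)"
    by (intro sum.cong) auto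
  also have "\<dots> = h d" using dY by simp
  finally show ?thesis using power_supported_power [OF r d(1)] d by simp
next
  case False
  hence "(\<Sum>d\<in>{1..Y}. if m = d ^ r then h d else 0) = 0" by (intro sum.neutral) auto
  moreover have "power_supported r h m = 0"
    unfolding power_supported_def using False by (rule if_not_P)
  ultimately show ?thesis by simp
qed

text \<open>The N(d) of the overview is \<open>quotient_count x (d ^ r)\<close>.\<close>

definition quotient_count :: "real \<Rightarrow> nat \<Rightarrow> nat" where
  "quotient_count x m = card {n \<in> {1..nat \<lfloor>x\<rfloor>}. nat \<lfloor>x / real n\<rfloor> = m}"

lemma nat_floor_div_eq_iff:
  assumes "x \<ge> 0" "n \<ge> 1"
  shows "nat \<lfloor>x / real n\<rfloor> = m \<longleftrightarrow> real m * real n \<le> x \<and> x < (real m + 1) * real n"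
proof -
  have "nat \<lfloor>x / real n\<rfloor> = m \<longleftrightarrow> \<lfloor>x / real n\<rfloor> = int m"
    using assms by (intro iffI) auto
  also have "\<dots> \<longleftrightarrow> real m \<le> x / real n \<and> x / real n < real m + 1"
    by (simp add: floor_eq_iff)
  finally show ?thesis using assms by (simp add: field_simps)
qed

text \<open>The condition n \<le> x is implied by m n \<le> x, so only x/(m+1) < n \<le> x/m
  remains.\<close>

lemma quotient_set_eq:
  assumes x: "x > 0" and m: "m \<ge> 1"
  shows "{n \<in> {1..nat \<lfloor>x\<rfloor>}. nat \<lfloor>x / real n\<rfloor> = m} = {nat \<lfloor>x / (real m + 1)\<rfloor><..nat \<lfloor>x / real m\<rfloor>}"
proof -
  have le: "n \<le> nat \<lfloor>y\<rfloor> \<longleftrightarrow> real n \<le> y" if "y \<ge> 0" for n and y :: real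
    using that by (simp add: le_nat_iff le_floor_iff)
  have lt: "nat \<lfloor>y\<rfloor> < n \<longleftrightarrow> y < real n" if "y \<ge> 0" for n and y :: real
    using le [OF that, of n] by linarith
  have "n \<in> {1..nat \<lfloor>x\<rfloor>} \<and> nat \<lfloor>x / real n\<rfloor> = m \<longleftrightarrow> x / (real m + 1) < real n \<and> real n \<le> x / real m" for n
  proof (cases "n \<ge> 1")
    case True
    have "real n \<le> x" if "real m * real n \<le> x"
    proof -
      have "1 * real n \<le> real m * real n" using m by (intro mult_right_mono) auto
      thus ?thesis using that by simp
    qed
    thus ?thesis using True nat_floor_div_eq_iff [of x n m] x m le [of x n]
      by (auto simp: field_simps)
  next
    case False
    hence "n = 0" by simp
    thus ?thesis using x m by (auto simp: field_simps)
  qed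
  moreover have "n \<in> {nat \<lfloor>x / (real m + 1)\<rfloor><..nat \<lfloor>x / real m\<rfloor>} \<longleftrightarrow> x / (real m + 1) < real n \<and> real n \<le> x / real m" for n
    using lt [of "x / (real m + 1)" n] le [of "x / real m" n] x by simp
  ultimately show ?thesis by blast
qed

text \<open>The count is a difference of two floors, and each floor loses an amount in
  [0,1).\<close>

lemma quotient_count_approx:
  assumes x: "x > 0" and m: "m \<ge> 1"
  shows "\<bar>real (quotient_count x m) - x / (real m * (real m + 1))\<bar> < 1"
proof -
  have le: "x / (real m + 1) \<le> x / real m" using x m by (intro divide_left_mono) auto
  have "quotient_count x m = nat \<lfloor>x / real m\<rfloor> - nat \<lfloor>x / (real m + 1)\<rfloor>"
    unfolding quotient_count_def quotient_set_eq [OF x m] by simp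
  moreover have "nat \<lfloor>x / (real m + 1)\<rfloor> \<le> nat \<lfloor>x / real m\<rfloor>" using le by (intro nat_mono floor_mono)
  ultimately have "real (quotient_count x m) = real (nat \<lfloor>x / real m\<rfloor>) - real (nat \<lfloor>x / (real m + 1)\<rfloor>)"
    by (simp add: of_nat_diff)
  also have "\<dots> = of_int \<lfloor>x / real m\<rfloor> - of_int \<lfloor>x / (real m + 1)\<rfloor>" using x by simp
  finally have "real (quotient_count x m) = of_int \<lfloor>x / real m\<rfloor> - of_int \<lfloor>x / (real m + 1)\<rfloor>" .
  moreover have "x / (real m * (real m + 1)) = x / real m - x / (real m + 1)"
    using m by (simp add: field_simps)
  ultimately show ?thesis by linarith
qed

text \<open>Here the expected count is at most 1, so the true count is below 2, that is 0 or 1, and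
  it can be 1 only for a quotient. The expected count itself goes into the error.\<close>

lemma quotient_count_large:
  assumes x: "x > 0" and d: "d \<ge> 1" and big: "x \<le> real d ^ (2 * r)"
  shows "\<bar>real (quotient_count x (d ^ r)) - x / (real (d ^ r) * (real (d ^ r) + 1))\<bar>
     \<le> (if d \<in> power_quotients r x then 1 else 0) + x / real d ^ (2 * r)"
proof -
  define m where "m = d ^ r"
  have m: "m \<ge> 1" using d by (simp add: m_def)
  have m2: "real d ^ (2 * r) = real m * real m" by (simp add: m_def power_add mult_2)
  have lt: "x / (real m * (real m + 1)) \<le> x / real d ^ (2 * r)"
    unfolding m2 using x m by (intro divide_left_mono mult_left_mono mult_pos_pos) auto
  also have "\<dots> \<le> 1" using big d by simp
  finally have "real (quotient_count x m) < 2" using quotient_count_approx [OF x m] by linarith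
  hence le1: "quotient_count x m \<le> 1" by linarith
  have "d \<in> power_quotients r x" if "quotient_count x m \<noteq> 0"
  proof -
    from that obtain n where "n \<in> {1..nat \<lfloor>x\<rfloor>}" "nat \<lfloor>x / real n\<rfloor> = m"
      unfolding quotient_count_def by (metis (mono_tags, lifting) card.empty empty_Collect_eq)
    hence "real m * real n \<le> x \<and> x < (real m + 1) * real n"
      using nat_floor_div_eq_iff [of x n m] x by auto
    thus ?thesis using d by (auto simp: power_quotients_def m_def)
  qed
  hence "real (quotient_count x m) \<le> (if d \<in> power_quotients r x then 1 else 0)"
    using le1 by auto
  moreover have "x / (real m * (real m + 1)) \<ge> 0" using x by simp
  ultimately show ?thesis using lt unfolding m_def [symmetric] by linarith
qed

lemma sum_power_supported_floor:
  assumes r: "r \<ge> 1" and x: "x \<ge> 0" and Y: "nat \<lfloor>x\<rfloor> \<le> Y"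
  shows "(\<Sum>n\<in>{1..nat \<lfloor>x\<rfloor>}. power_supported r h (nat \<lfloor>x / real n\<rfloor>))
    = (\<Sum>d\<in>{1..Y}. h d * of_nat (quotient_count x (d ^ r)))"
proof -
  have "(\<Sum>n\<in>{1..nat \<lfloor>x\<rfloor>}. power_supported r h (nat \<lfloor>x / real n\<rfloor>))
      = (\<Sum>n\<in>{1..nat \<lfloor>x\<rfloor>}. \<Sum>d\<in>{1..Y}. if nat \<lfloor>x / real n\<rfloor> = d ^ r then h d else 0)"
  proof (intro sum.cong refl power_supported_eq_sum r)
    fix n assume "n \<in> {1..nat \<lfloor>x\<rfloor>}"
    hence "x / real n \<le> x / 1" using x by (intro divide_left_mono) auto
    hence "nat \<lfloor>x / real n\<rfloor> \<le> nat \<lfloor>x\<rfloor>" by (intro nat_mono floor_mono) simp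
    thus "nat \<lfloor>x / real n\<rfloor> \<le> Y" using Y by simp
  qed
  also have "\<dots> = (\<Sum>d\<in>{1..Y}. \<Sum>n\<in>{1..nat \<lfloor>x\<rfloor>}. if nat \<lfloor>x / real n\<rfloor> = d ^ r then h d else 0)"
    by (rule sum.swap)
  also have "\<dots> = (\<Sum>d\<in>{1..Y}. h d * of_nat (quotient_count x (d ^ r)))"
    unfolding quotient_count_def by (intro sum.cong refl) (simp add: sum.inter_filter [symmetric])
  finally show ?thesis .
qed

lemma quotient_count_eq_0:
  assumes "x \<ge> 0" "m > nat \<lfloor>x\<rfloor>"
  shows "quotient_count x m = 0"
proof -
  have "nat \<lfloor>x / real n\<rfloor> \<noteq> m" if "n \<ge> 1" for n
  proof -
    have "x / real n \<le> x / 1" using that assms by (intro divide_left_mono) auto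
    hence "nat \<lfloor>x / real n\<rfloor> \<le> nat \<lfloor>x\<rfloor>" by (intro nat_mono floor_mono) simp
    thus ?thesis using assms by linarith
  qed
  thus ?thesis by (auto simp: quotient_count_def)
qed

text \<open>Bounds uniform in Y make the error series \<open>u\<close> absolutely convergent, while
  \<open>v\<close> has finite support and sum S. As \<open>w\<close> is (v - u)/x termwise, the
  series for the constant converges as well, and its value times x differs from S by the sum of
  \<open>u\<close>.\<close>

lemma quotient_error_bound:
  fixes r :: nat and h :: "nat \<Rightarrow> complex" and x B :: real
  assumes r: "r \<ge> 1" and x: "x > 0"
    and bound: "\<And>Y. (\<Sum>d\<in>{1..Y}. norm (h d) *
       \<bar>real (quotient_count x (d ^ r)) - x / (real (d ^ r) * (real (d ^ r) + 1))\<bar>) \<le> B"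
  shows "norm ((\<Sum>n\<in>{1..nat \<lfloor>x\<rfloor>}. power_supported r h (nat \<lfloor>x / real n\<rfloor>))
           - (\<Sum>n. power_supported r h (n + 1) / (of_nat (n + 1) * of_nat (n + 2))) * of_real x) \<le> B"
proof -
  define S where "S = (\<Sum>n\<in>{1..nat \<lfloor>x\<rfloor>}. power_supported r h (nat \<lfloor>x / real n\<rfloor>))"
  define f where "f = (\<lambda>n. power_supported r h (n + 1) / (of_nat (n + 1) * of_nat (n + 2)))"
  define \<mu> where "\<mu> = (\<lambda>d. real (Suc d ^ r) * (real (Suc d ^ r) + 1))"
  define v where "v = (\<lambda>d. h (Suc d) * of_nat (quotient_count x (Suc d ^ r)))"
  define u where "u = (\<lambda>d. h (Suc d) * of_real (real (quotient_count x (Suc d ^ r)) - x / \<mu> d))"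
  define w where "w = (\<lambda>d. h (Suc d) / of_real (\<mu> d))"
  have shift: "(\<Sum>d<Y. g (Suc d)) = (\<Sum>d\<in>{1..Y}. g d)" for g :: "nat \<Rightarrow> 'b::comm_monoid_add" and Y
    by (rule sum.reindex_bij_witness [of _ "\<lambda>d. d - 1" Suc]) auto
  have partial: "(\<Sum>d<Y. norm (u d)) \<le> B" for Y
  proof -
    have "(\<Sum>d<Y. norm (u d)) = (\<Sum>d<Y. (\<lambda>d. norm (h d) *
       \<bar>real (quotient_count x (d ^ r)) - x / (real (d ^ r) * (real (d ^ r) + 1))\<bar>) (Suc d))"
      unfolding u_def \<mu>_def norm_mult norm_of_real ..
    also have "\<dots> = (\<Sum>d\<in>{1..Y}. norm (h d) *
       \<bar>real (quotient_count x (d ^ r)) - x / (real (d ^ r) * (real (d ^ r) + 1))\<bar>)"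
      by (rule shift)
    finally show ?thesis using bound by simp
  qed
  have sum_nu: "summable (\<lambda>d. norm (u d))"
  proof (rule bounded_imp_summable)
    show "(\<Sum>d\<le>n. norm (u d)) \<le> B" for n
      using partial [of "Suc n"] by (simp only: lessThan_Suc_atMost)
  qed simp
  have u_sums: "u sums suminf u" using sum_nu summable_norm_cancel by blast
  have norm_u: "norm (suminf u) \<le> B"
    using summable_norm [OF sum_nu] suminf_le_const [OF sum_nu partial] by linarith
  have v_sums: "v sums S"
  \<comment> \<open>Terms with d at least the integer part of x vanish, because (d+1)^r \<ge> d+1
    then exceeds it.\<close>
  proof -
    have "v sums (\<Sum>d<nat \<lfloor>x\<rfloor>. v d)"
    proof (rule sums_finite)
      fix d assume "d \<notin> {..<nat \<lfloor>x\<rfloor>}"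
      moreover have "Suc d ^ 1 \<le> Suc d ^ r" using r by (intro power_increasing) auto
      ultimately have "Suc d ^ r > nat \<lfloor>x\<rfloor>" by simp
      thus "v d = 0" unfolding v_def using quotient_count_eq_0 [of x "Suc d ^ r"] x by simp
    qed auto
    also have "(\<Sum>d<nat \<lfloor>x\<rfloor>. v d) = S"
      unfolding S_def v_def sum_power_supported_floor [OF r less_imp_le [OF x] order_refl]
      by (rule shift)
    finally show ?thesis .
  qed
  have w_eq: "w d = (v d - u d) / of_real x" for d
  proof -
    have "v d - u d = h (Suc d) * of_real (x / \<mu> d)"
      unfolding u_def v_def by (simp add: algebra_simps)
    thus ?thesis using x by (simp add: w_def)
  qed
  have w_sums: "w sums ((S - suminf u) / of_real x)"
    unfolding w_eq [abs_def] by (intro sums_divide sums_diff v_sums u_sums)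
  \<comment> \<open>The series \<open>f\<close> starts at index 0 for n = 1, so the power (d+1)^r
    sits at index (d+1)^r - 1. Off these indices \<open>f\<close> is 0, and the series can be
    reindexed by d.\<close>
  define g where "g = (\<lambda>d. Suc d ^ r - 1)"
  have g1: "g d + 1 = Suc d ^ r" for d by (simp add: g_def)
  have "strict_mono g"
  proof (rule strict_monoI)
    fix d e :: nat assume "d < e"
    hence "Suc d ^ r < Suc e ^ r" using r by (intro power_strict_mono) auto
    thus "g d < g e" using g1 [of d] g1 [of e] by linarith
  qed
  moreover have "f n = 0" if "n \<notin> range g" for n
  proof -
    have "\<not> (\<exists>d. d \<ge> 1 \<and> n + 1 = d ^ r)"
    proof
      assume "\<exists>d. d \<ge> 1 \<and> n + 1 = d ^ r"
      then obtain d where d: "d \<ge> 1" "n + 1 = d ^ r" by auto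
      hence "n = g (d - 1)" by (simp add: g_def)
      thus False using that by blast
    qed
    hence "power_supported r h (n + 1) = 0"
      unfolding power_supported_def by (rule if_not_P)
    thus ?thesis by (simp add: f_def)
  qed
  ultimately have "(\<lambda>d. f (g d)) sums c \<longleftrightarrow> f sums c" for c by (rule sums_mono_reindex)
  moreover have "f (g d) = w d" for d
  proof -
    have "f (g d) = power_supported r h (g d + 1) / (of_nat (g d + 1) * (of_nat (g d + 1) + 1))"
      by (simp add: f_def)
    thus ?thesis unfolding g1 using r
      by (simp add: power_supported_power w_def \<mu>_def del: of_nat_Suc power_Suc)
  qed
  ultimately have "f sums ((S - suminf u) / of_real x)" using w_sums by simp
  hence "suminf f * of_real x = S - suminf u" using x by (simp add: sums_iff)
  hence "S - suminf f * of_real x = suminf u" by simp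
  thus ?thesis using norm_u unfolding S_def f_def by simp
qed

section \<open>Assembling the error term\<close>

theorem theorem1:
  fixes r :: nat and h :: "nat \<Rightarrow> complex" and \<alpha> K :: real
  assumes r: "r \<ge> 1"
    and alpha: "0 \<le> \<alpha>" "\<alpha> < (real r + 2 - eta_par r) / (2 * real r - 2 + 2 * eta_par r)"
    and hbound: "\<forall>d::nat. d \<ge> 1 \<longrightarrow> norm (h d) \<le> K * real d powr \<alpha>"
  shows "\<exists>M::real. \<forall>x::real. x \<ge> 2 \<longrightarrow>
     norm ((\<Sum>n\<in>{1..nat \<lfloor>x\<rfloor>}. power_supported r h (nat \<lfloor>x / real n\<rfloor>))
           - (\<Sum>n. power_supported r h (n + 1) / (of_nat (n + 1) * of_nat (n + 2))) * of_real x)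
     \<le> M * x powr (2 * (1 + \<alpha>) / (3 * real r + eta_par r))"
proof -
  \<comment> \<open>With this choice 2s+1 is the largest odd number not exceeding r.\<close>
  define s where "s = (r - 1) div 2"
  define k where "k = r + s + 1"
  have rs: "2 * s + 1 \<le> r" using r by (simp add: s_def)
  have s_eq: "2 * real s + 2 = real r + eta_par r"
  proof (cases "odd r")
    case True
    then obtain j where "r = 2 * j + 1" by (auto elim: oddE)
    thus ?thesis by (simp add: s_def eta_par_def)
  next
    case False
    then obtain j where j: "r = 2 * j" by (auto elim: evenE)
    hence "j \<ge> 1" using r by simp
    then obtain i where "j = Suc i" by (cases j) auto
    thus ?thesis using j by (simp add: s_def eta_par_def)
  qed
  have k2: "3 * real r + eta_par r = 2 * real k" using s_eq by (simp add: k_def)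
  have \<alpha>: "\<alpha> < real (r - s) / real (2 * s + 1)"
  proof -
    have "real r + 2 - eta_par r = 2 * real (r - s)" using s_eq rs by (simp add: of_nat_diff)
    moreover have "2 * real r - 2 + 2 * eta_par r = 2 * real (2 * s + 1)" using s_eq by simp
    ultimately show ?thesis using alpha(2) by (simp only: mult_divide_mult_cancel_left_if) simp
  qed
  \<comment> \<open>The quotient is at most r-s \<le> 2r-1, which makes the sum of d^(\<alpha>-2r)
    converge.\<close>
  have "real (r - s) / real (2 * s + 1) \<le> real (r - s) / 1" by (intro divide_left_mono) auto
  hence \<alpha>_lt: "\<alpha> < 2 * real r - 1" using \<alpha> r by simp
  define \<gamma> where "\<gamma> = \<alpha> - 2 * real r"
  have \<gamma>: "\<gamma> < -1" using \<alpha>_lt by (simp add: \<gamma>_def)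
  have K: "K \<ge> 0" using hbound [rule_format, of 1] norm_ge_zero [of "h 1"] by (simp del: norm_ge_zero)
  show ?thesis
  proof (rule sum_powr_power_quotients_le [OF rs \<alpha>])
    fix K0 C :: real
    assume K0: "K0 \<ge> 1" and C: "C \<ge> 0"
      and Csum: "\<And>x T. x \<ge> 1 \<Longrightarrow> finite T \<Longrightarrow> T \<subseteq> power_quotients r x \<Longrightarrow>
       (\<And>d. d \<in> T \<Longrightarrow> K0 * x powr (1 / real (r + s + 1)) < real d) \<Longrightarrow>
       (\<Sum>d\<in>T. real d powr \<alpha>) \<le> C * x powr ((1 + \<alpha>) / real (r + s + 1))"
    define c\<^sub>1 where "c\<^sub>1 = 2 * 2 powr \<bar>\<gamma>\<bar> / (1 - 2 powr (\<gamma> + 1))"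
    have c1: "c\<^sub>1 \<ge> 0" unfolding c\<^sub>1_def using \<gamma>
      by (intro divide_nonneg_nonneg) (auto simp: powr_less_one intro!: less_imp_le)
    \<comment> \<open>The three parts come from the d \<le> D, from the expected counts beyond D,
      and from the quotients beyond D.\<close>
    define M where "M = K * ((1 + c\<^sub>1) * K0 powr (1 + \<alpha>) + C)"
    show ?thesis
    proof (intro exI [of _ M] allI impI)
      fix x :: real assume x2: "x \<ge> 2"
      hence x: "x > 0" and x1: "x \<ge> 1" by auto
      define D where "D = K0 * x powr (1 / real k)"
      have xk: "x powr (1 / real k) \<ge> 1" using x1 by (intro ge_one_powr_ge_zero) auto
      hence D1: "D \<ge> 1" unfolding D_def using K0 mult_mono [of 1 K0 1 "x powr (1 / real k)"] by simp
      have D_powr: "D powr (1 + \<alpha>) = K0 powr (1 + \<alpha>) * x powr ((1 + \<alpha>) / real k)"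
        unfolding D_def using K0 x by (simp add: powr_mult powr_powr)
      \<comment> \<open>Already D^k \<ge> x, and k = r+s+1 \<le> 2r. Hence every d > D falls under
        \<open>quotient_count_large\<close>.\<close>
      have Dx: "x \<le> D ^ (2 * r)"
      proof -
        have "x = (x powr (1 / real k)) powr real k" using x by (simp add: powr_powr k_def)
        also have "\<dots> = (x powr (1 / real k)) ^ k" using x by (subst powr_realpow) auto
        also have "\<dots> \<le> D ^ k"
          unfolding D_def using K0 xk mult_right_mono [of 1 K0 "x powr (1 / real k)"]
          by (intro power_mono) auto
        also have "\<dots> \<le> D ^ (2 * r)" using D1 rs by (intro power_increasing) (auto simp: k_def)
        finally show ?thesis .
      qed
      define E where "E = (\<lambda>d. \<bar>real (quotient_count x (d ^ r)) - x / (real (d ^ r) * (real (d ^ r) + 1))\<bar>)"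
      have "(\<Sum>d\<in>{1..Y}. norm (h d) * E d) \<le> M * x powr ((1 + \<alpha>) / real k)" for Y
      proof -
        define I where "I = {d \<in> {1..Y}. real d \<le> D}"
        define J where "J = {d \<in> {1..Y}. D < real d}"
        define T where "T = {d \<in> J. d \<in> power_quotients r x}"
        have fin: "finite I" "finite J" "finite T" by (auto simp: I_def J_def T_def)
        have split: "(\<Sum>d\<in>{1..Y}. norm (h d) * E d) = (\<Sum>d\<in>I. norm (h d) * E d) + (\<Sum>d\<in>J. norm (h d) * E d)"
          by (subst sum.union_disjoint [symmetric]) (auto simp: I_def J_def intro!: sum.cong)
        have hE: "norm (h d) * E d \<le> K * (real d powr \<alpha> * b)" if "d \<ge> 1" "E d \<le> b" for d b
        proof -
          have "E d \<ge> 0" by (simp add: E_def)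
          hence "norm (h d) * E d \<le> (K * real d powr \<alpha>) * b"
            using hbound that K by (intro mult_mono) auto
          thus ?thesis by (simp add: mult.assoc)
        qed
        have "(\<Sum>d\<in>I. norm (h d) * E d) \<le> (\<Sum>d\<in>I. K * D powr \<alpha>)"
        proof (rule sum_mono)
          fix d assume "d \<in> I"
          hence d: "d \<ge> 1" "real d \<le> D" by (auto simp: I_def)
          have "E d \<le> 1" unfolding E_def using quotient_count_approx [OF x, of "d ^ r"] d by simp
          hence "norm (h d) * E d \<le> K * (real d powr \<alpha> * 1)" by (intro hE d)
          also have "\<dots> \<le> K * (D powr \<alpha> * 1)"
            using K d alpha(1) by (intro mult_left_mono mult_right_mono powr_mono2) auto
          finally show "norm (h d) * E d \<le> K * D powr \<alpha>" by simp
        qed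
        also have "\<dots> = real (card I) * (K * D powr \<alpha>)" by simp
        also have "\<dots> \<le> D * (K * D powr \<alpha>)"
        proof (rule mult_right_mono)
          have "card I \<le> card {1..nat \<lfloor>D\<rfloor>}"
            by (intro card_mono) (auto simp: I_def le_nat_iff le_floor_iff)
          hence "real (card I) \<le> real (nat \<lfloor>D\<rfloor>)" by simp
          also have "\<dots> \<le> D" using D1 by auto
          finally show "real (card I) \<le> D" .
        qed (use K in simp)
        also have "\<dots> = K * D powr (1 + \<alpha>)" using D1 by (simp add: powr_add)
        finally have I_le: "(\<Sum>d\<in>I. norm (h d) * E d) \<le> K * D powr (1 + \<alpha>)" .
        have "(\<Sum>d\<in>J. norm (h d) * E d)
            \<le> (\<Sum>d\<in>J. K * ((if d \<in> power_quotients r x then real d powr \<alpha> else 0) + x * real d powr \<gamma>))"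
        proof (rule sum_mono)
          fix d assume "d \<in> J"
          hence d: "d \<ge> 1" "D < real d" by (auto simp: J_def)
          have "D ^ (2 * r) \<le> real d ^ (2 * r)" using d D1 by (intro power_mono) auto
          hence big: "x \<le> real d ^ (2 * r)" using Dx by linarith
          have "E d \<le> (if d \<in> power_quotients r x then 1 else 0) + x / real d ^ (2 * r)"
            unfolding E_def by (rule quotient_count_large [OF x d(1) big])
          hence "norm (h d) * E d \<le> K * (real d powr \<alpha> * ((if d \<in> power_quotients r x then 1 else 0) + x / real d ^ (2 * r)))"
            by (intro hE d)
          also have "real d powr \<gamma> = real d powr \<alpha> / real d ^ (2 * r)"
          proof -
            have "real d ^ (2 * r) = real d powr (2 * real r)"
              using d powr_realpow [of "real d" "2 * r"] by simp
            thus ?thesis by (simp add: \<gamma>_def powr_diff)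
          qed
          hence "K * (real d powr \<alpha> * ((if d \<in> power_quotients r x then 1 else 0) + x / real d ^ (2 * r)))
             = K * ((if d \<in> power_quotients r x then real d powr \<alpha> else 0) + x * real d powr \<gamma>)"
            by (simp add: algebra_simps)
          finally show "norm (h d) * E d \<le> \<dots>" .
        qed
        also have "\<dots> = K * ((\<Sum>d\<in>T. real d powr \<alpha>) + x * (\<Sum>d\<in>J. real d powr \<gamma>))"
          unfolding T_def sum.inter_filter [OF fin(2)] sum_distrib_left [symmetric] sum.distrib ..
        also have "\<dots> \<le> K * (C * x powr ((1 + \<alpha>) / real k) + c\<^sub>1 * D powr (1 + \<alpha>))"
        proof (intro mult_left_mono add_mono K)
          show "(\<Sum>d\<in>T. real d powr \<alpha>) \<le> C * x powr ((1 + \<alpha>) / real k)"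
            unfolding k_def by (intro Csum x1 fin) (auto simp: T_def J_def D_def k_def)
          \<comment> \<open>By x \<le> D^(2r), the tail x D^(\<gamma>+1) is at most
            D^(2r+\<gamma>+1) = D^(1+\<alpha>), the same size as the contribution of d \<le>
            D.\<close>
          have "x * (\<Sum>d\<in>J. real d powr \<gamma>) \<le> x * (2 * 2 powr \<bar>\<gamma>\<bar> * D powr (\<gamma> + 1) / (1 - 2 powr (\<gamma> + 1)))"
            using x by (intro mult_left_mono sum_powr_tail_le D1 \<gamma> fin) (auto simp: J_def)
          also have "\<dots> = c\<^sub>1 * (x * D powr (\<gamma> + 1))" by (simp add: c\<^sub>1_def)
          also have "x * D powr (\<gamma> + 1) \<le> D ^ (2 * r) * D powr (\<gamma> + 1)"
            using Dx by (intro mult_right_mono) auto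
          also have "D ^ (2 * r) = D powr (2 * real r)"
            using D1 powr_realpow [of D "2 * r"] by simp
          also have "D powr (2 * real r) * D powr (\<gamma> + 1) = D powr (1 + \<alpha>)"
            by (simp add: powr_add [symmetric] \<gamma>_def add.commute)
          finally show "x * (\<Sum>d\<in>J. real d powr \<gamma>) \<le> c\<^sub>1 * D powr (1 + \<alpha>)"
            using c1 by (simp add: mult_left_mono)
        qed
        finally have "(\<Sum>d\<in>{1..Y}. norm (h d) * E d) \<le> K * D powr (1 + \<alpha>) +
            K * (C * x powr ((1 + \<alpha>) / real k) + c\<^sub>1 * D powr (1 + \<alpha>))"
          using I_le split by linarith
        also have "\<dots> = M * x powr ((1 + \<alpha>) / real k)"
          unfolding M_def D_powr by (simp add: algebra_simps)
        finally show ?thesis .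
      qed
      hence "norm ((\<Sum>n\<in>{1..nat \<lfloor>x\<rfloor>}. power_supported r h (nat \<lfloor>x / real n\<rfloor>))
           - (\<Sum>n. power_supported r h (n + 1) / (of_nat (n + 1) * of_nat (n + 2))) * of_real x)
          \<le> M * x powr ((1 + \<alpha>) / real k)"
        unfolding E_def by (rule quotient_error_bound [OF r x])
      moreover have "2 * (1 + \<alpha>) / (3 * real r + eta_par r) = (1 + \<alpha>) / real k"
        unfolding k2 by (rule mult_divide_mult_cancel_left) simp
      ultimately show "norm ((\<Sum>n\<in>{1..nat \<lfloor>x\<rfloor>}. power_supported r h (nat \<lfloor>x / real n\<rfloor>))
           - (\<Sum>n. power_supported r h (n + 1) / (of_nat (n + 1) * of_nat (n + 2))) * of_real x)
          \<le> M * x powr (2 * (1 + \<alpha>) / (3 * real r + eta_par r))"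
        by (simp only:)
    qed
  qed
qed

end
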